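(* Let $n\ge2$ and $0\le k<n$ be integers, and let $\Phi$ and $\Phi_1$ be two arbitrary Orlicz functions with corresponding Orlicz spaces $L(\Phi)$ and $L(\Phi_1)$ over $(0,\Delta)$. Put $$\overline{W}_{n,k}(\Phi,\Phi_1)=\inf_{\Delta\in(0,\infty)}\ \sup_{g\in Z(n,k),\ g^{(n)}\ne0}\left[\frac{\|T_\Delta g\|L(\Phi)}{\phi(L(\Phi),\Delta/(n+1))}:\frac{\|T_\Delta g^{(n)}\|L(\Phi_1)}{\phi(L(\Phi_1),\Delta)}\right].$$ Then $$\overline{W}_{n,k}(\Phi,\Phi_1)\ge\frac{k^k\,(n-k)^{n-k}}{n!\,(n+1)^n}.$$
   Context: **The class $Z(n,k)$.** $Z(n,k)$ is the set of functions $g:[0,1]\to\mathbb{R}$ having a generalized derivative $g^{(n)}$ of order $n$ on $[0,1]$ with $g^{(i)}(0)=0$ for $i=0,\dots,k-1$ and $g^{(j)}(1)=0$ for $j=0,\dots,n-k-1$. **Dilation.** $T_\Delta[g](x)=g(x/\Delta)$ for $x\in(0,\Delta)$, $\Delta>0$. **Orlicz norm.** For an Orlicz function $\Phi$, the norm of a measurable function $h:(0,\Delta)\to\mathbb{R}$ in $L(\Phi)$ is $$\|h\|L(\Phi)=\inf_{v>0}v^{-1}\left[1+\int_0^\Delta\Phi(v\,h(x))\,dx\right].$$ The fundamental function of $L(\Phi)$ is $$\phi(L(\Phi),\delta)=\inf_{v>0}v^{-1}\left[1+\delta\,\Phi(v)\right].$$ **Conventions.** $u:v$ denotes the quotient $u/v$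 (equal to $0$ when $v=\infty$ and $u<\infty$), and $0^0=1$. *)

theory Defs
  imports "HOL-Analysis.Analysis"
begin

text \<open>
  Orlicz functions are taken in the wide sense: even, convex, vanishing at \<open>0\<close>, tending to
  infinity, and allowed to take the value \<open>\<infinity>\<close> as long as they are finite somewhere away from \<open>0\<close>
  (so that \<open>L\<^sub>\<infinity>\<close> is an Orlicz space too).  Convexity is spelled out because \<^const>\<open>convex_on\<close>
  is restricted to real-valued functions.
\<close>

definition orlicz_function :: "(real \<Rightarrow> ennreal) \<Rightarrow> bool" where
  "orlicz_function \<Phi> \<longleftrightarrow>
     \<Phi> 0 = 0 \<and>
     (\<forall>u. \<Phi> (- u) = \<Phi> u) \<and>
     (\<forall>x y t. 0 \<le> t \<and> t \<le> 1 \<longrightarrow>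
        \<Phi> ((1 - t) * x + t * y) \<le> ennreal (1 - t) * \<Phi> x + ennreal t * \<Phi> y) \<and>
     (\<Phi> \<longlongrightarrow> top) at_top \<and>
     (\<exists>u>0. \<Phi> u < top)"

definition orlicz_norm :: "(real \<Rightarrow> ennreal) \<Rightarrow> real \<Rightarrow> (real \<Rightarrow> real) \<Rightarrow> ennreal" where
  "orlicz_norm \<Phi> \<Delta> h =
     (INF v\<in>{0<..}. ennreal (inverse v) * (1 + (\<integral>\<^sup>+x. \<Phi> (v * h x) \<partial>lebesgue_on {0<..<\<Delta>})))"

definition fundamental_function :: "(real \<Rightarrow> ennreal) \<Rightarrow> real \<Rightarrow> ennreal" where
  "fundamental_function \<Phi> \<delta> = (INF v\<in>{0<..}. ennreal (inverse v) * (1 + ennreal \<delta> * \<Phi> v))"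

definition dilation :: "real \<Rightarrow> (real \<Rightarrow> real) \<Rightarrow> real \<Rightarrow> real" where
  "dilation \<Delta> g x = g (x / \<Delta>)"

definition absolutely_continuous_on :: "real set \<Rightarrow> (real \<Rightarrow> real) \<Rightarrow> bool" where
  "absolutely_continuous_on S f \<longleftrightarrow>
     (\<forall>\<epsilon>>0. \<exists>\<delta>>0. \<forall>(N::nat) a b.
        (\<forall>i<N. a i \<le> b i \<and> {a i..b i} \<subseteq> S) \<and>
        disjoint_family_on (\<lambda>i. {a i<..<b i}) {..<N} \<and>
        (\<Sum>i<N. b i - a i) < \<delta> \<longrightarrow>
        (\<Sum>i<N. \<bar>f (b i) - f (a i)\<bar>) < \<epsilon>)"

text \<open>
  The derivatives of a function on \<open>[0,1]\<close>, one-sided at the end points.  They depend only on the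
  restriction of the function to \<open>[0,1]\<close>.  At a point of non-differentiability the value is a
  junk constant; for the derivative of top order of a function in the class \<open>gen_diff n\<close> below, such
  points form a null set, so the value there is irrelevant to norms and to almost-everywhere
  statements.
\<close>

primrec nth_deriv :: "nat \<Rightarrow> (real \<Rightarrow> real) \<Rightarrow> real \<Rightarrow> real" where
  "nth_deriv 0 g = g"
| "nth_deriv (Suc i) g = (\<lambda>x. vector_derivative (nth_deriv i g) (at x within {0..1}))"

text \<open>
  For \<open>n \<ge> 1\<close>: \<open>g\<close> has a generalized derivative of order \<open>n\<close> on \<open>[0,1]\<close> iff its classical derivatives
  of order less than \<open>n\<close> exist and the one of order \<open>n - 1\<close> is absolutely continuous on \<open>[0,1]\<close>.
  Then \<^term>\<open>nth_deriv n g\<close> exists almost everywhere and represents the generalized derivative.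
\<close>

definition gen_diff :: "nat \<Rightarrow> (real \<Rightarrow> real) \<Rightarrow> bool" where
  "gen_diff n g \<longleftrightarrow>
     (\<forall>i<n - 1. nth_deriv i g differentiable_on {0..1}) \<and>
     absolutely_continuous_on {0..1} (nth_deriv (n - 1) g)"

definition Z :: "nat \<Rightarrow> nat \<Rightarrow> (real \<Rightarrow> real) set" where
  "Z n k = {g. gen_diff n g \<and> (\<forall>i<k. nth_deriv i g 0 = 0) \<and> (\<forall>j<n - k. nth_deriv j g 1 = 0)}"

text \<open>
  The condition \<open>g\<^sup>(\<^sup>n\<^sup>) \<noteq> 0\<close> means that the generalized derivative is not almost everywhere zero.
  Quotients are those of \<^typ>\<open>ennreal\<close>, where \<open>u / \<infinity> = 0\<close>.  The numerator norm is finite because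
  \<open>g\<close> is bounded, and the denominator norm may be infinite.
\<close>

definition W_bar :: "nat \<Rightarrow> nat \<Rightarrow> (real \<Rightarrow> ennreal) \<Rightarrow> (real \<Rightarrow> ennreal) \<Rightarrow> ennreal" where
  "W_bar n k \<Phi> \<Phi>\<^sub>1 =
     (INF \<Delta>\<in>{0<..}.
        SUP g\<in>{g \<in> Z n k. \<not> (AE x in lebesgue_on {0..1}. nth_deriv n g x = 0)}.
          (orlicz_norm \<Phi> \<Delta> (dilation \<Delta> g) / fundamental_function \<Phi> (\<Delta> / real (n + 1))) /
          (orlicz_norm \<Phi>\<^sub>1 \<Delta> (dilation \<Delta> (nth_deriv n g)) / fundamental_function \<Phi>\<^sub>1 \<Delta>))"

end

theory Submission
  imports Defs
begin

text \<open>
  The lower bound is witnessed, simultaneously for all \<open>\<Delta>\<close>, \<open>\<Phi>\<close> and \<open>\<Phi>\<^sub>1\<close>, by the single polynomial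
  \<open>g(x) = x\<^sup>k (1 - x)\<^sup>n\<^sup>-\<^sup>k\<close>.  Its zeros at \<open>0\<close> and \<open>1\<close> have exactly the orders that \<open>Z(n,k)\<close> asks for.

  An Orlicz norm is a homogeneous lattice norm, and its fundamental function at \<open>\<delta>\<close> is the norm of
  the indicator of any set of measure \<open>\<delta>\<close> (\<open>orlicz_norm_mono\<close>, \<open>orlicz_norm_scale\<close>,
  \<open>orlicz_norm_indicator\<close>).  Two consequences give the two halves of the quotient.

  The derivative \<open>g\<^sup>(\<^sup>n\<^sup>)\<close> is the constant \<open>\<plusminus>n!\<close>, so its norm divided by \<open>\<phi>(L(\<Phi>\<^sub>1), \<Delta>)\<close>
  is \<open>n!\<close>.

  On the interval with end points \<open>k/(n+1)\<close> and \<open>(k+1)/(n+1)\<close> one has \<open>x \<ge> k/(n+1)\<close> and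
  \<open>1 - x \<ge> (n-k)/(n+1)\<close>, whence \<open>g \<ge> m\<close> with \<open>m = k\<^sup>k (n-k)\<^sup>n\<^sup>-\<^sup>k / (n+1)\<^sup>n\<close>
  (\<open>test_poly_lower_bound\<close>).  After dilation this interval has measure \<open>\<Delta>/(n+1)\<close>, which is precisely
  the argument at which \<open>\<phi>(L(\<Phi>), \<cdot>)\<close> is evaluated; hence the norm of \<open>T\<^sub>\<Delta> g\<close> is at least
  \<open>m \<phi>(L(\<Phi>), \<Delta>/(n+1))\<close>.  The quotient is therefore at least \<open>m / n!\<close> for every \<open>\<Delta>\<close>.
  The cancellations are legitimate because the fundamental function of an Orlicz space is
  positive and finite at every positive argument.
\<close>

section \<open>Orlicz norms and fundamental functions\<close>

lemma orlicz_function_scale: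
  assumes "orlicz_function \<Phi>" "0 \<le> t" "t \<le> 1"
  shows "\<Phi> (t * y) \<le> ennreal t * \<Phi> y"
proof -
  have "\<Phi> ((1 - t) * 0 + t * y) \<le> ennreal (1 - t) * \<Phi> 0 + ennreal t * \<Phi> y"
    using assms unfolding orlicz_function_def by blast
  then show ?thesis using assms(1) by (simp add: orlicz_function_def)
qed

lemma orlicz_function_mono:
  assumes "orlicz_function \<Phi>" "\<bar>x\<bar> \<le> \<bar>y\<bar>"
  shows "\<Phi> x \<le> \<Phi> y"
proof -
  have even: "\<Phi> \<bar>u\<bar> = \<Phi> u" for u
    using assms(1) by (auto simp: orlicz_function_def abs_if)
  define t where "t = \<bar>x\<bar> / \<bar>y\<bar>"
  have t: "0 \<le> t" "t \<le> 1" "\<bar>x\<bar> = t * \<bar>y\<bar>"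
    using assms(2) by (auto simp: t_def divide_le_eq_1)
  have "\<Phi> x = \<Phi> (t * \<bar>y\<bar>)" using even[of x] t(3) by simp
  also have "\<dots> \<le> ennreal t * \<Phi> \<bar>y\<bar>" by (rule orlicz_function_scale[OF assms(1) t(1,2)])
  also have "\<dots> \<le> 1 * \<Phi> \<bar>y\<bar>" using t by (intro mult_right_mono) auto
  finally show ?thesis by (simp add: even)
qed

lemma orlicz_norm_mono:
  assumes "orlicz_function \<Phi>" "\<And>x. x \<in> {0<..<\<Delta>} \<Longrightarrow> \<bar>f x\<bar> \<le> \<bar>h x\<bar>"
  shows "orlicz_norm \<Phi> \<Delta> f \<le> orlicz_norm \<Phi> \<Delta> h"
  unfolding orlicz_norm_def
proof (rule INF_superset_mono[OF subset_refl])
  fix v :: real assume "v \<in> {0<..}"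
  then have "\<Phi> (v * f x) \<le> \<Phi> (v * h x)" if "x \<in> {0<..<\<Delta>}" for x
    using assms(2)[OF that] by (intro orlicz_function_mono[OF assms(1)]) (simp add: abs_mult)
  then show "ennreal (inverse v) * (1 + (\<integral>\<^sup>+x. \<Phi> (v * f x) \<partial>lebesgue_on {0<..<\<Delta>}))
      \<le> ennreal (inverse v) * (1 + (\<integral>\<^sup>+x. \<Phi> (v * h x) \<partial>lebesgue_on {0<..<\<Delta>}))"
    by (intro mult_left_mono add_left_mono nn_integral_mono) auto
qed

lemma orlicz_norm_scale_le:
  assumes "c > 0"
  shows "ennreal c * orlicz_norm \<Phi> \<Delta> h \<le> orlicz_norm \<Phi> \<Delta> (\<lambda>x. c * h x)"
proof -
  have "ennreal c * orlicz_norm \<Phi> \<Delta> h \<le>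
      ennreal (inverse v) * (1 + (\<integral>\<^sup>+x. \<Phi> (v * (c * h x)) \<partial>lebesgue_on {0<..<\<Delta>}))" (is "_ \<le> _ * ?I")
    if v: "v > 0" for v
  proof -
    have "orlicz_norm \<Phi> \<Delta> h \<le>
        ennreal (inverse (v * c)) * (1 + (\<integral>\<^sup>+x. \<Phi> (v * c * h x) \<partial>lebesgue_on {0<..<\<Delta>}))"
      unfolding orlicz_norm_def by (rule INF_lower) (use v assms in simp)
    then have "orlicz_norm \<Phi> \<Delta> h \<le> ennreal (inverse (v * c)) * ?I" by (simp add: mult.assoc)
    then have "ennreal c * orlicz_norm \<Phi> \<Delta> h \<le> ennreal c * (ennreal (inverse (v * c)) * ?I)"
      by (rule mult_left_mono) simp
    also have "\<dots> = ennreal (c * inverse (v * c)) * ?I"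
      using v assms by (simp add: ennreal_mult' mult.assoc)
    also have "c * inverse (v * c) = inverse v" using assms v by (simp add: field_simps)
    finally show ?thesis .
  qed
  then show ?thesis
    unfolding orlicz_norm_def[of \<Phi> \<Delta> "\<lambda>x. c * h x"] by (intro INF_greatest) simp
qed

text \<open>The reverse inequality is the same inequality for the factor \<open>1/c\<close>.\<close>

lemma orlicz_norm_scale:
  assumes "c > 0"
  shows "orlicz_norm \<Phi> \<Delta> (\<lambda>x. c * h x) = ennreal c * orlicz_norm \<Phi> \<Delta> h"
proof (rule antisym)
  have "ennreal (1 / c) * orlicz_norm \<Phi> \<Delta> (\<lambda>x. c * h x) \<le> orlicz_norm \<Phi> \<Delta> (\<lambda>x. 1 / c * (c * h x))"
    by (rule orlicz_norm_scale_le) (use assms in simp)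
  also have "(\<lambda>x. 1 / c * (c * h x)) = h" using assms by simp
  finally have "ennreal c * (ennreal (1 / c) * orlicz_norm \<Phi> \<Delta> (\<lambda>x. c * h x))
      \<le> ennreal c * orlicz_norm \<Phi> \<Delta> h" by (rule mult_left_mono) simp
  also have "ennreal c * (ennreal (1 / c) * orlicz_norm \<Phi> \<Delta> (\<lambda>x. c * h x)) =
      ennreal (c * (1 / c)) * orlicz_norm \<Phi> \<Delta> (\<lambda>x. c * h x)"
    using assms by (subst ennreal_mult) (auto simp: mult.assoc)
  finally show "orlicz_norm \<Phi> \<Delta> (\<lambda>x. c * h x) \<le> ennreal c * orlicz_norm \<Phi> \<Delta> h"
    using assms by simp
qed (rule orlicz_norm_scale_le[OF assms])

lemma orlicz_norm_indicator:
  assumes "\<Phi> 0 = 0" "A \<in> sets lebesgue" "A \<subseteq> {0<..<\<Delta>}" "emeasure lebesgue A = ennreal \<delta>"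
  shows "orlicz_norm \<Phi> \<Delta> (indicator A) = fundamental_function \<Phi> \<delta>"
proof -
  have "(\<integral>\<^sup>+x. \<Phi> (v * indicator A x) \<partial>lebesgue_on {0<..<\<Delta>}) = ennreal \<delta> * \<Phi> v" for v
  proof -
    have "(\<integral>\<^sup>+x. \<Phi> (v * indicator A x) \<partial>lebesgue_on {0<..<\<Delta>}) =
        (\<integral>\<^sup>+x. \<Phi> v * indicator A x \<partial>lebesgue_on {0<..<\<Delta>})"
      using assms(1) by (intro nn_integral_cong) (auto simp: indicator_def)
    also have "\<dots> = \<Phi> v * emeasure (lebesgue_on {0<..<\<Delta>}) A"
      by (rule nn_integral_cmult_indicator) (use assms in \<open>auto simp: sets_restrict_space_iff\<close>)
    also have "emeasure (lebesgue_on {0<..<\<Delta>}) A = ennreal \<delta>"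
      using assms by (simp add: emeasure_restrict_space)
    finally show ?thesis by (simp add: mult.commute)
  qed
  then show ?thesis by (simp add: orlicz_norm_def fundamental_function_def)
qed

lemma fundamental_function_finite:
  assumes "orlicz_function \<Phi>"
  shows "fundamental_function \<Phi> \<delta> \<noteq> top"
proof -
  obtain u where u: "u > 0" "\<Phi> u < top" using assms by (auto simp: orlicz_function_def)
  have "fundamental_function \<Phi> \<delta> \<le> ennreal (inverse u) * (1 + ennreal \<delta> * \<Phi> u)"
    unfolding fundamental_function_def by (rule INF_lower) (use u in simp)
  also have "\<dots> < top" using u by (simp add: ennreal_mult_less_top)
  finally show ?thesis by simp
qed

text \<open>
  Pick \<open>u\<close> with \<open>\<Phi>(u) \<ge> 1\<close>.  For \<open>v \<le> u\<close> the summand \<open>1/v\<close> is at least \<open>1/u\<close>; for \<open>v \<ge> u\<close> convexity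
  makes \<open>\<Phi>\<close> grow at least linearly, so \<open>\<delta> \<Phi>(v) / v \<ge> \<delta>/u\<close>.
\<close>

lemma fundamental_function_pos:
  assumes "orlicz_function \<Phi>" "\<delta> > 0"
  shows "fundamental_function \<Phi> \<delta> \<noteq> 0"
proof -
  have "(\<Phi> \<longlongrightarrow> top) at_top" using assms by (simp add: orlicz_function_def)
  then have "eventually (\<lambda>u. 1 < \<Phi> u) at_top" by (rule order_tendstoD) simp
  then have "eventually (\<lambda>u. 1 < \<Phi> u \<and> u > 0) at_top"
    using eventually_gt_at_top by (rule eventually_conj)
  then obtain u where u: "1 < \<Phi> u" "u > 0"
    using eventually_happens by fastforce
  have "ennreal (min 1 \<delta> / u) \<le> ennreal (inverse v) * (1 + ennreal \<delta> * \<Phi> v)" if v: "v > 0" for v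
  proof (cases "v \<le> u")
    case True
    have "min 1 \<delta> / u \<le> inverse v"
      using True v u assms by (simp add: field_simps min_def) (smt (verit) mult_less_cancel_right1)
    then have "ennreal (min 1 \<delta> / u) \<le> ennreal (inverse v) * 1" by (simp add: ennreal_leI)
    also have "\<dots> \<le> ennreal (inverse v) * (1 + ennreal \<delta> * \<Phi> v)" by (intro mult_left_mono) auto
    finally show ?thesis .
  next
    case False
    have "1 \<le> \<Phi> (u / v * v)" using u v by simp
    also have "\<dots> \<le> ennreal (u / v) * \<Phi> v"
      by (rule orlicz_function_scale) (use assms u v False in auto)
    finally have "ennreal (\<delta> / u) * 1 \<le> ennreal (\<delta> / u) * (ennreal (u / v) * \<Phi> v)"
      by (rule mult_left_mono) simp
    also have "\<dots> = ennreal (\<delta> / u * (u / v)) * \<Phi> v"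
      using assms u v by (subst ennreal_mult) (auto simp: mult.assoc)
    also have "\<delta> / u * (u / v) = inverse v * \<delta>" using u by (simp add: field_simps)
    also have "ennreal (inverse v * \<delta>) * \<Phi> v = ennreal (inverse v) * (ennreal \<delta> * \<Phi> v)"
      using assms v by (subst ennreal_mult) (auto simp: mult.assoc)
    also have "\<dots> \<le> ennreal (inverse v) * (1 + ennreal \<delta> * \<Phi> v)" by (intro mult_left_mono) auto
    finally have "ennreal (\<delta> / u) \<le> ennreal (inverse v) * (1 + ennreal \<delta> * \<Phi> v)" by simp
    moreover have "ennreal (min 1 \<delta> / u) \<le> ennreal (\<delta> / u)"
      using u by (intro ennreal_leI divide_right_mono) auto
    ultimately show ?thesis by (rule order_trans[rotated])
  qed
  then have "ennreal (min 1 \<delta> / u) \<le> fundamental_function \<Phi> \<delta>"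
    unfolding fundamental_function_def by (intro INF_greatest) simp
  moreover have "ennreal (min 1 \<delta> / u) > 0" using u assms by simp
  ultimately show ?thesis by auto
qed

section \<open>Polynomials in the class \<open>Z(n,k)\<close>\<close>

lemma nth_deriv_poly:
  assumes "x \<in> {0..1}"
  shows "nth_deriv i (poly p) x = poly ((pderiv ^^ i) p) x"
  using assms
proof (induction i arbitrary: x)
  case (Suc i)
  have "(poly ((pderiv ^^ i) p) has_vector_derivative poly ((pderiv ^^ Suc i) p) x) (at x within {0..1})"
    using poly_DERIV[of "(pderiv ^^ i) p" x]
    by (simp add: has_real_derivative_iff_has_vector_derivative has_vector_derivative_at_within)
  then have "(nth_deriv i (poly p) has_vector_derivative poly ((pderiv ^^ Suc i) p) x) (at x within {0..1})"
    by (rule has_vector_derivative_transform[rotated 2]) (use Suc in auto)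
  then show ?case
    using Suc.prems by (simp add: vector_derivative_within_closed_interval)
qed simp

lemma lipschitz_imp_absolutely_continuous_on:
  assumes "L-lipschitz_on S f"
  shows "absolutely_continuous_on S f"
  unfolding absolutely_continuous_on_def
proof (intro allI impI)
  fix \<epsilon> :: real assume "\<epsilon> > 0"
  have L: "L \<ge> 0" using assms by (rule lipschitz_on_nonneg)
  show "\<exists>\<delta>>0. \<forall>(N::nat) a b. (\<forall>i<N. a i \<le> b i \<and> {a i..b i} \<subseteq> S) \<and>
        disjoint_family_on (\<lambda>i. {a i<..<b i}) {..<N} \<and> (\<Sum>i<N. b i - a i) < \<delta> \<longrightarrow>
        (\<Sum>i<N. \<bar>f (b i) - f (a i)\<bar>) < \<epsilon>"
    \<comment> \<open>\<open>L + 1\<close> instead of \<open>L\<close>, since \<open>L\<close> may be \<open>0\<close>\<close>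
  proof (intro exI[of _ "\<epsilon> / (L + 1)"] conjI allI impI; (elim conjE)?)
    show "\<epsilon> / (L + 1) > 0" using \<open>\<epsilon> > 0\<close> L by simp
    fix N :: nat and a b :: "nat \<Rightarrow> real"
    assume ab: "\<forall>i<N. a i \<le> b i \<and> {a i..b i} \<subseteq> S" and small: "(\<Sum>i<N. b i - a i) < \<epsilon> / (L + 1)"
    have "(\<Sum>i<N. \<bar>f (b i) - f (a i)\<bar>) \<le> (\<Sum>i<N. (L + 1) * (b i - a i))"
    proof (rule sum_mono)
      fix i assume "i \<in> {..<N}"
      then have i: "a i \<le> b i" "a i \<in> S" "b i \<in> S" using ab by force+
      have "\<bar>f (b i) - f (a i)\<bar> \<le> L * (b i - a i)"
        using lipschitz_onD[OF assms i(3,2)] i(1) by (simp add: dist_real_def)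
      also have "\<dots> \<le> (L + 1) * (b i - a i)" using i(1) by (intro mult_right_mono) auto
      finally show "\<bar>f (b i) - f (a i)\<bar> \<le> (L + 1) * (b i - a i)" .
    qed
    also have "\<dots> = (L + 1) * (\<Sum>i<N. b i - a i)" by (simp add: sum_distrib_left)
    also have "\<dots> < \<epsilon>" using small L by (simp add: field_simps)
    finally show "(\<Sum>i<N. \<bar>f (b i) - f (a i)\<bar>) < \<epsilon>" .
  qed
qed

lemma poly_lipschitz_on_unit_interval:
  fixes p :: "real poly"
  shows "\<exists>L. L-lipschitz_on {0..1} (poly p)"
proof -
  have "compact (poly (pderiv p) ` {0..1})"
    by (intro compact_continuous_image continuous_intros) auto
  then obtain C where C: "C > 0" "\<And>x. x \<in> {0..1} \<Longrightarrow> \<bar>poly (pderiv p) x\<bar> \<le> C"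
    by (auto dest!: compact_imp_bounded simp: bounded_pos)
  have "C-lipschitz_on {0..1} (poly p)"
  proof (rule bounded_derivative_imp_lipschitz)
    fix x :: real assume "x \<in> {0..1}"
    show "(poly p has_derivative (*) (poly (pderiv p) x)) (at x within {0..1})"
      using poly_DERIV[of p x] by (simp add: has_field_derivative_def has_derivative_at_withinI)
    have "onorm ((*) (poly (pderiv p) x)) \<le> \<bar>poly (pderiv p) x\<bar>"
      by (rule onorm_bound) (auto simp: abs_mult)
    also have "\<dots> \<le> C" using C \<open>x \<in> {0..1}\<close> by blast
    finally show "onorm ((*) (poly (pderiv p) x)) \<le> C" .
  qed (use C in auto)
  then show ?thesis ..
qed

lemma gen_diff_poly: "gen_diff n (poly p)"
  unfolding gen_diff_def
proof (intro conjI allI impI)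
  fix i
  have "poly ((pderiv ^^ i) p) differentiable_on {0..1}"
    unfolding differentiable_on_def real_differentiable_def
    by (blast intro: DERIV_subset[OF poly_DERIV subset_UNIV])
  then show "nth_deriv i (poly p) differentiable_on {0..1}"
    unfolding differentiable_on_def
    by (auto intro: differentiable_transform_within[where d = 1] simp: nth_deriv_poly)
next
  obtain L where "L-lipschitz_on {0..1} (poly ((pderiv ^^ (n - 1)) p))"
    using poly_lipschitz_on_unit_interval by blast
  then have "L-lipschitz_on {0..1} (nth_deriv (n - 1) (poly p))"
    by (rule lipschitz_on_transform) (simp add: nth_deriv_poly)
  then show "absolutely_continuous_on {0..1} (nth_deriv (n - 1) (poly p))"
    by (rule lipschitz_imp_absolutely_continuous_on)
qed

text \<open>Each differentiation removes at most one factor \<open>q\<close>, so one is left after \<open>i < k\<close> of them.\<close>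

lemma poly_higher_pderiv_eq_0:
  fixes p q :: "real poly"
  assumes "q ^ k dvd p" "i < k" "poly q a = 0"
  shows "poly ((pderiv ^^ i) p) a = 0"
  using assms(1,2)
proof (induction i arbitrary: p k)
  case 0
  then have "q dvd p" by (meson dvd_power dvd_trans)
  then show ?case using assms(3) by auto
next
  case (Suc i)
  from Suc.prems obtain m where k: "k = Suc m" by (cases k) auto
  obtain r where p: "p = q ^ Suc m * r" using Suc.prems(1) unfolding k by (rule dvdE)
  have "pderiv p = q ^ m * (q * pderiv r + r * smult (of_nat (Suc m)) (pderiv q))"
    unfolding p pderiv_mult pderiv_power_Suc by (simp add: algebra_simps)
  then have "q ^ m dvd pderiv p" by simp
  then have "poly ((pderiv ^^ i) (pderiv p)) a = 0"
    using Suc.IH[of m "pderiv p"] Suc.prems k by simp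
  then show ?case by (simp add: funpow_swap1)
qed

lemma higher_pderiv_degree:
  fixes p :: "real poly"
  shows "(pderiv ^^ degree p) p = [:fact (degree p) * lead_coeff p:]"
proof -
  have "degree ((pderiv ^^ degree p) p) = 0" by (simp add: degree_higher_pderiv)
  then have "(pderiv ^^ degree p) p = [:coeff ((pderiv ^^ degree p) p) 0:]"
    by (metis degree_0_id)
  then show ?thesis by (simp add: coeff_higher_pderiv pochhammer_fact)
qed

section \<open>The test polynomial\<close>

definition test_poly :: "nat \<Rightarrow> nat \<Rightarrow> real poly" where
  "test_poly n k = [:0, 1:] ^ k * [:1, -1:] ^ (n - k)"

lemma poly_test_poly: "poly (test_poly n k) x = x ^ k * (1 - x) ^ (n - k)"
  by (simp add: test_poly_def)

lemma test_poly_in_Z: "poly (test_poly n k) \<in> Z n k"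
  unfolding Z_def
  using poly_higher_pderiv_eq_0[of "[:0, 1:]" k "test_poly n k" _ 0]
    poly_higher_pderiv_eq_0[of "[:1, -1:]" "n - k" "test_poly n k" _ 1]
  by (auto simp: gen_diff_poly nth_deriv_poly test_poly_def)

lemma nth_deriv_test_poly:
  assumes "k \<le> n" "x \<in> {0..1}"
  shows "\<bar>nth_deriv n (poly (test_poly n k)) x\<bar> = fact n"
proof -
  have "degree (test_poly n k) = n"
    using assms(1) by (simp add: test_poly_def degree_mult_eq degree_power_eq)
  moreover have "\<bar>lead_coeff (test_poly n k)\<bar> = 1"
    by (simp add: test_poly_def lead_coeff_mult lead_coeff_power power_abs)
  ultimately show ?thesis
    using higher_pderiv_degree[of "test_poly n k"] assms(2) by (simp add: nth_deriv_poly abs_mult)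
qed

text \<open>
  The interval has length \<open>1/(n+1)\<close> and contains the maximum point \<open>k/n\<close>.  Its left end bounds the
  factor \<open>x\<^sup>k\<close> and its right end the factor \<open>(1 - x)\<^sup>n\<^sup>-\<^sup>k\<close>, and the product of these two bounds is
  already the required constant.
\<close>

lemma test_poly_lower_bound:
  assumes "k \<le> n" "real k / real (n + 1) \<le> x" "x \<le> real (k + 1) / real (n + 1)"
  shows "real k ^ k * real (n - k) ^ (n - k) / real (n + 1) ^ n \<le> poly (test_poly n k) x"
proof -
  have "0 \<le> x" using assms(2) by (rule order_trans[rotated]) simp
  have "real (n - k) / real (n + 1) \<le> 1 - x"
    using assms by (simp add: field_simps of_nat_diff)
  then have "(real k / real (n + 1)) ^ k * (real (n - k) / real (n + 1)) ^ (n - k)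
      \<le> x ^ k * (1 - x) ^ (n - k)"
    using assms(2) \<open>0 \<le> x\<close> by (intro mult_mono power_mono) auto
  moreover have "real (n + 1) ^ n = real (n + 1) ^ k * real (n + 1) ^ (n - k)"
    using assms(1) by (simp flip: power_add)
  ultimately show ?thesis by (simp add: poly_test_poly power_divide)
qed

section \<open>The lower bound\<close>

text \<open>The test polynomial dominates a multiple of the indicator of the dilated interval.\<close>

lemma orlicz_norm_test_poly_ge:
  assumes "orlicz_function \<Phi>" "k < n" "\<Delta> > 0"
  shows "ennreal (real k ^ k * real (n - k) ^ (n - k) / real (n + 1) ^ n) *
      fundamental_function \<Phi> (\<Delta> / real (n + 1)) \<le> orlicz_norm \<Phi> \<Delta> (dilation \<Delta> (poly (test_poly n k)))"
    (is "ennreal ?m * _ \<le> _")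
proof -
  define A where "A = {\<Delta> * (real k / real (n + 1))<..<\<Delta> * (real (k + 1) / real (n + 1))}"
  have m: "?m > 0" using assms(2) by (cases "k = 0") auto
  have "\<Delta> * (real (k + 1) / real (n + 1)) \<le> \<Delta> * 1"
    using assms by (intro mult_left_mono) auto
  moreover have "0 \<le> \<Delta> * (real k / real (n + 1))" using assms(3) by simp
  ultimately have sub: "A \<subseteq> {0<..<\<Delta>}" unfolding A_def by auto
  have "\<Delta> * (real k / real (n + 1)) \<le> \<Delta> * (real (k + 1) / real (n + 1))"
    using assms by (intro mult_left_mono divide_right_mono) auto
  then have "emeasure lebesgue A = ennreal (\<Delta> * (real (k + 1) / real (n + 1)) - \<Delta> * (real k / real (n + 1)))"
    by (simp add: A_def)
  also have "\<Delta> * (real (k + 1) / real (n + 1)) - \<Delta> * (real k / real (n + 1)) = \<Delta> / real (n + 1)"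
    unfolding right_diff_distrib[symmetric] diff_divide_distrib[symmetric] by simp
  finally have "emeasure lebesgue A = ennreal (\<Delta> / real (n + 1))" .
  then have "ennreal ?m * fundamental_function \<Phi> (\<Delta> / real (n + 1)) =
      ennreal ?m * orlicz_norm \<Phi> \<Delta> (indicator A)"
    using assms(1) sub by (subst orlicz_norm_indicator) (auto simp: orlicz_function_def A_def)
  also have "\<dots> = orlicz_norm \<Phi> \<Delta> (\<lambda>x. ?m * indicator A x)"
    using orlicz_norm_scale[OF m] by simp
  also have "\<dots> \<le> orlicz_norm \<Phi> \<Delta> (dilation \<Delta> (poly (test_poly n k)))"
  proof (rule orlicz_norm_mono[OF assms(1)])
    fix x
    show "\<bar>?m * indicator A x\<bar> \<le> \<bar>dilation \<Delta> (poly (test_poly n k)) x\<bar>"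
    proof (cases "x \<in> A")
      case True
      then have "real k / real (n + 1) \<le> x / \<Delta>" "x / \<Delta> \<le> real (k + 1) / real (n + 1)"
        using assms(3) by (auto simp: A_def field_simps)
      then have "?m \<le> poly (test_poly n k) (x / \<Delta>)"
        using assms(2) by (intro test_poly_lower_bound) auto
      then show ?thesis using True m by (simp add: dilation_def)
    qed simp
  qed
  finally show ?thesis .
qed

text \<open>
  Norms see only absolute values on the open interval from \<open>0\<close> to \<open>\<Delta>\<close>, where the derivative
  of order \<open>n\<close> has absolute value \<open>n!\<close>.
\<close>

lemma orlicz_norm_deriv_test_poly:
  assumes "orlicz_function \<Phi>" "k \<le> n" "\<Delta> > 0"
  shows "orlicz_norm \<Phi> \<Delta> (dilation \<Delta> (nth_deriv n (poly (test_poly n k)))) =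
    ennreal (fact n) * fundamental_function \<Phi> \<Delta>"
proof -
  have "\<bar>dilation \<Delta> (nth_deriv n (poly (test_poly n k))) x\<bar> = \<bar>fact n * indicator {0<..<\<Delta>} x\<bar>"
    if "x \<in> {0<..<\<Delta>}" for x
    using that assms nth_deriv_test_poly[of k n "x / \<Delta>"] by (simp add: dilation_def)
  then have "orlicz_norm \<Phi> \<Delta> (dilation \<Delta> (nth_deriv n (poly (test_poly n k)))) =
      orlicz_norm \<Phi> \<Delta> (\<lambda>x. fact n * indicator {0<..<\<Delta>} x)"
    by (intro antisym orlicz_norm_mono assms(1)) simp_all
  also have "\<dots> = ennreal (fact n) * orlicz_norm \<Phi> \<Delta> (indicator {0<..<\<Delta>})"
    by (rule orlicz_norm_scale) simp
  also have "orlicz_norm \<Phi> \<Delta> (indicator {0<..<\<Delta>}) = fundamental_function \<Phi> \<Delta>"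
    using assms by (intro orlicz_norm_indicator) (auto simp: orlicz_function_def)
  finally show ?thesis .
qed

theorem theorem6p1:
  fixes n k :: nat and \<Phi> \<Phi>\<^sub>1 :: "real \<Rightarrow> ennreal"
  assumes "n \<ge> 2" and "k < n"
    and "orlicz_function \<Phi>" and "orlicz_function \<Phi>\<^sub>1"
  shows "W_bar n k \<Phi> \<Phi>\<^sub>1 \<ge>
    ennreal (real k ^ k * real (n - k) ^ (n - k) / (fact n * real (n + 1) ^ n))"
  unfolding W_bar_def
proof (rule INF_greatest)
  fix \<Delta> :: real assume "\<Delta> \<in> {0<..}"
  then have \<Delta>: "\<Delta> > 0" by simp
  let ?g = "poly (test_poly n k)"
  let ?m = "real k ^ k * real (n - k) ^ (n - k) / real (n + 1) ^ n"
  let ?\<phi> = "fundamental_function \<Phi> (\<Delta> / real (n + 1))"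
  let ?\<phi>\<^sub>1 = "fundamental_function \<Phi>\<^sub>1 \<Delta>"
  have "?\<phi> \<noteq> 0" "?\<phi> \<noteq> top"
    using assms(3) \<Delta> by (simp_all add: fundamental_function_pos fundamental_function_finite)
  then have "ennreal ?m = ennreal ?m * ?\<phi> / ?\<phi>" by (simp add: ennreal_mult_divide_eq)
  also have "\<dots> \<le> orlicz_norm \<Phi> \<Delta> (dilation \<Delta> ?g) / ?\<phi>"
    by (intro divide_right_mono_ennreal orlicz_norm_test_poly_ge assms \<Delta>)
  finally have numerator: "ennreal ?m \<le> orlicz_norm \<Phi> \<Delta> (dilation \<Delta> ?g) / ?\<phi>" .
  have "?\<phi>\<^sub>1 \<noteq> 0" "?\<phi>\<^sub>1 \<noteq> top"
    using assms(4) \<Delta> by (simp_all add: fundamental_function_pos fundamental_function_finite)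
  then have denominator:
    "orlicz_norm \<Phi>\<^sub>1 \<Delta> (dilation \<Delta> (nth_deriv n ?g)) / ?\<phi>\<^sub>1 = ennreal (fact n)"
    using assms \<Delta> by (simp add: orlicz_norm_deriv_test_poly ennreal_mult_divide_eq)
  have "\<not> (AE x in lebesgue_on {0..1}. nth_deriv n ?g x = 0)"
  proof
    assume "AE x in lebesgue_on {0..1}. nth_deriv n ?g x = 0"
    moreover have "AE x in lebesgue_on {0..1}. nth_deriv n ?g x \<noteq> 0"
    proof (rule AE_I2)
      fix x :: real assume "x \<in> space (lebesgue_on {0..1})"
      then have "\<bar>nth_deriv n ?g x\<bar> = fact n" using assms(2) by (intro nth_deriv_test_poly) auto
      then show "nth_deriv n ?g x \<noteq> 0" by auto
    qed
    ultimately have "AE x in lebesgue_on {0..1::real}. False" by eventually_elim simp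
    then have "emeasure (lebesgue_on {0..1::real}) (space (lebesgue_on {0..1})) = 0"
      by (simp add: eventually_False ae_filter_eq_bot_iff)
    then show False by (simp add: emeasure_restrict_space)
  qed
  then have g: "?g \<in> {g \<in> Z n k. \<not> (AE x in lebesgue_on {0..1}. nth_deriv n g x = 0)}"
    using test_poly_in_Z by simp
  have "ennreal (real k ^ k * real (n - k) ^ (n - k) / (fact n * real (n + 1) ^ n)) = ennreal (?m / fact n)"
    by (simp add: mult.commute)
  also have "\<dots> = ennreal ?m / ennreal (fact n)" by (rule divide_ennreal[symmetric]) auto
  also have "\<dots> \<le> (orlicz_norm \<Phi> \<Delta> (dilation \<Delta> ?g) / ?\<phi>) /
      (orlicz_norm \<Phi>\<^sub>1 \<Delta> (dilation \<Delta> (nth_deriv n ?g)) / ?\<phi>\<^sub>1)"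
    unfolding denominator by (rule divide_right_mono_ennreal[OF numerator])
  also have "\<dots> \<le> (SUP g\<in>{g \<in> Z n k. \<not> (AE x in lebesgue_on {0..1}. nth_deriv n g x = 0)}.
      (orlicz_norm \<Phi> \<Delta> (dilation \<Delta> g) / ?\<phi>) /
      (orlicz_norm \<Phi>\<^sub>1 \<Delta> (dilation \<Delta> (nth_deriv n g)) / ?\<phi>\<^sub>1))"
    by (rule SUP_upper[OF g])
  finally show "ennreal (real k ^ k * real (n - k) ^ (n - k) / (fact n * real (n + 1) ^ n)) \<le> \<dots>" .
qed

end
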